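(* Consider a capacity achieving PMF $\mathbf{p}^*$ with operating point $(E^*,I^* )$, where $E^*=\mathbf{w}^T\mathbf{p}^*$ and $I^*=\mathcal{I}(\mathbf{p}^* )=\mathcal{C}(E^* )$, and the corresponding capacity achieving joint PMFs $\mathbf{p}^{(n)*}$ on $\mathcal{X}^n$, $n\in\mathbb{N}$ (that is, $\mathbf{p}^{(n)*}$ is the product of $n$ copies of $\mathbf{p}^*$). Assume $\mathcal{C}(E)$ is strictly concave in $E$. For $$\tilde{\mathbf{p}}^{(n)}=\mathrm{GHC}(\mathbf{p}^{(n)*})\quad\text{and}\quad(\tilde{E}_n,\tilde{I}_n)=\Bigl(\frac{\mathcal{E}(\tilde{\mathbf{p}}^{(n)})}{n},\frac{\mathcal{I}(\tilde{\mathbf{p}}^{(n)})}{n}\Bigr)$$ we have $$(\tilde{E}_n,\tilde{I}_n)\to(E^*,I^* )\quad\text{as } n\to\infty.$$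
   Context: Channel: a discrete-time memoryless channel with additive noise $Y=X+Z$. The input $X$ takes values in a finite signal constellation $\mathcal{X}=\{x_1,\dots,x_m\}\subset\mathbb{C}$ with $|\mathcal{X}|=m$; the noise $Z$ takes values in $\mathbb{C}$ and is distributed according to a density $h$; conditioned on $X=x_i$, the output $Y$ has density $h_i(y)=h(y-x_i)$. Put $w_i=|x_i|^2$ and $\mathbf{w}=(w_1,\dots,w_m)^T$. For an input PMF $\mathbf{p}=(p_1,\dots,p_m)^T$ the mutual information between $X$ and $Y$ is $$\mathcal{I}(\mathbf{p})=-\int_{\mathbb{C}}\Bigl(\sum_i p_ih_i(y)\Bigr)\log\Bigl(\sum_i p_ih_i(y)\Bigr)dy+\sum_i p_i\int_{\mathbb{C}}h_i(y)\log h_i(y)\,dy.$$ Capacity curve: $\mathcal{C}(E)$ is the maximum of $\mathcal{I}(\mathbf{p})$ over all PMFs $\mathbf{p}$ on $\mathcal{X}$ with $\mathbf{w}^T\mathbf{p}\le E$. A PMF $\mathbf{p}^*$ is capacity achieving if it attains this maximum for $E=E^*=\mathbf{w}^T\mathbf{p}^*$. Blocks: for a joint PMF $\mathbf{p}^{(n)}$ of $n$ consecutive signal points, $\mathcal{I}(\mathbf{p}^{(n)})$ is the mutual information between the block of $n$ inputs (distributed according to $\mathbf{p}^{(n)}$) and the block of the corresponding $n$ outputs of the memoryless channel, and $\mathcal{E}(\mathbf{p}^{(n)})=\sum_{\mathbf{x}\in\mathcal{X}^n}p^{(n)}(\mathbf{x})\Vert\mathbf{x}\Vert^2$, where $\mathcal{X}^n$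 is the Cartesian product of $n$ copies of $\mathcal{X}$ and $\Vert\cdot\Vert$ is the Euclidean norm. Dyadic PMFs and GHC: a PMF on a finite set is dyadic if each of its entries is of the form $2^{-\ell}$ with $\ell\in\mathbb{N}$. The Kullback-Leibler distance between PMFs is $D(\mathbf{p}\Vert\mathbf{p}')=\sum_{\mathbf{x}}p(\mathbf{x})\log\frac{p(\mathbf{x})}{p'(\mathbf{x})}$. Geometric Huffman Coding (GHC) is an algorithm that, given a target PMF $\mathbf{p}'$, finds the optimal dyadic approximation of it: $\mathrm{GHC}(\mathbf{p}')$ minimizes $D(\mathbf{p}\Vert\mathbf{p}')$ over all dyadic PMFs $\mathbf{p}$ on the same set.
   Formalization: GHC minimizes either over dyadic PMFs that may also have zero entries, or over PMFs with all entries 2^-l on the support of p^(n)* (if p* has zeros, the literal class on X^n has D infinite throughout and the claim fails); the noise density is assumed to have h log h integrable. *)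

theory Defs
  imports "HOL-Probability.Probability"
begin

definition prob_density :: "(complex \<Rightarrow> real) \<Rightarrow> bool" where
  "prob_density h \<longleftrightarrow>
     h \<in> borel_measurable borel \<and> (\<forall>z. 0 \<le> h z) \<and> (\<integral>\<^sup>+z. ennreal (h z) \<partial>lborel) = 1"

text \<open>
  Input alphabet \<open>A\<close> (finite) and input PMF \<open>p\<close>; given input \<open>x\<close>, the output has density \<open>W x\<close>
  with respect to the reference measure \<open>M\<close>. Logarithms are to base 2 throughout, and
  \<open>log 2 0 = 0\<close> gives the usual convention \<open>0 log 0 = 0\<close>.
\<close>

definition output_density :: "'a set \<Rightarrow> ('a \<Rightarrow> 'b \<Rightarrow> real) \<Rightarrow> 'a pmf \<Rightarrow> 'b \<Rightarrow> real" where
  "output_density A W p y = (\<Sum>x\<in>A. pmf p x * W x y)"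

definition mutual_info :: "'b measure \<Rightarrow> 'a set \<Rightarrow> ('a \<Rightarrow> 'b \<Rightarrow> real) \<Rightarrow> 'a pmf \<Rightarrow> real" where
  "mutual_info M A W p =
     - (\<integral>y. output_density A W p y * log 2 (output_density A W p y) \<partial>M)
     + (\<Sum>x\<in>A. pmf p x * (\<integral>y. W x y * log 2 (W x y) \<partial>M))"

definition channel_info :: "(complex \<Rightarrow> real) \<Rightarrow> complex set \<Rightarrow> complex pmf \<Rightarrow> real" where
  "channel_info h X p = mutual_info lborel X (\<lambda>x y. h (y - x)) p"

definition energy :: "complex set \<Rightarrow> complex pmf \<Rightarrow> real" where
  "energy X p = (\<Sum>x\<in>X. pmf p x * (cmod x)\<^sup>2)"

definition capacity :: "(complex \<Rightarrow> real) \<Rightarrow> complex set \<Rightarrow> real \<Rightarrow> real" where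
  "capacity h X E = (SUP p\<in>{p. set_pmf p \<subseteq> X \<and> energy X p \<le> E}. channel_info h X p)"

definition capacity_achieving :: "(complex \<Rightarrow> real) \<Rightarrow> complex set \<Rightarrow> complex pmf \<Rightarrow> bool" where
  "capacity_achieving h X p \<longleftrightarrow>
     is_arg_max (channel_info h X) (\<lambda>q. set_pmf q \<subseteq> X \<and> energy X q \<le> energy X p) p"

lemma capacity_achieving_eq_capacity:
  assumes "capacity_achieving h X p"
  shows "channel_info h X p = capacity h X (energy X p)"
proof -
  have "capacity h X (energy X p) = channel_info h X p"
    unfolding capacity_def
    using assms
    by (intro cSup_eq_maximum) (auto simp: capacity_achieving_def is_arg_max_def not_less)
  then show ?thesis by simp
qed

definition strictly_concave_on :: "real set \<Rightarrow> (real \<Rightarrow> real) \<Rightarrow> bool" where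
  "strictly_concave_on S f \<longleftrightarrow>
     (\<forall>x\<in>S. \<forall>y\<in>S. \<forall>t. x \<noteq> y \<and> 0 < t \<and> t < 1 \<longrightarrow>
        t * f x + (1 - t) * f y < f (t * x + (1 - t) * y))"

text \<open>
  Once \<open>E\<close> exceeds the energy of some unconstrained maximizer of the mutual information, the
  capacity curve is constant, so it can be strictly concave only on the budgets at which the
  energy constraint is binding: those for which every smaller feasible budget gives a strictly
  smaller capacity. Below the least symbol energy no PMF is feasible.
\<close>

definition binding_budgets :: "(complex \<Rightarrow> real) \<Rightarrow> complex set \<Rightarrow> real set" where
  "binding_budgets h X =
     {E. Min ((\<lambda>x. (cmod x)\<^sup>2) ` X) \<le> E \<and>
         (\<forall>E'. Min ((\<lambda>x. (cmod x)\<^sup>2) ` X) \<le> E' \<and> E' < E \<longrightarrow> capacity h X E' < capacity h X E)}"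

text \<open>
  Blocks of length \<open>n\<close> are functions on \<open>{..<n}\<close>, extended by \<open>undefined\<close>, so that input
  blocks and output blocks live in the same kind of space as \<open>\<Pi>\<^sub>M i\<in>{..<n}. lborel\<close>.
\<close>

definition blocks :: "nat \<Rightarrow> 'a set \<Rightarrow> (nat \<Rightarrow> 'a) set" where
  "blocks n X = ({..<n} \<rightarrow>\<^sub>E X)"

definition iid_pmf :: "nat \<Rightarrow> 'a pmf \<Rightarrow> (nat \<Rightarrow> 'a) pmf" where
  "iid_pmf n p = Pi_pmf {..<n} undefined (\<lambda>_. p)"

definition block_info ::
  "(complex \<Rightarrow> real) \<Rightarrow> complex set \<Rightarrow> nat \<Rightarrow> (nat \<Rightarrow> complex) pmf \<Rightarrow> real" where
  "block_info h X n p =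
     mutual_info (\<Pi>\<^sub>M i\<in>{..<n}. lborel) (blocks n X) (\<lambda>x y. \<Prod>i<n. h (y i - x i)) p"

definition block_energy :: "complex set \<Rightarrow> nat \<Rightarrow> (nat \<Rightarrow> complex) pmf \<Rightarrow> real" where
  "block_energy X n p = (\<Sum>x\<in>blocks n X. pmf p x * (L2_set (\<lambda>i. cmod (x i)) {..<n})\<^sup>2)"

text \<open>
  Valued in the extended reals, because with real values the term \<open>p log (p / 0)\<close> would be
  \<open>0\<close> instead of \<open>\<infinity>\<close>.
\<close>

definition kl_dist :: "'a pmf \<Rightarrow> 'a pmf \<Rightarrow> ereal" where
  "kl_dist p p' =
     (if set_pmf p \<subseteq> set_pmf p'
      then ereal (\<Sum>x\<in>set_pmf p. pmf p x * log 2 (pmf p x / pmf p' x)) else \<infinity>)"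

definition dyadic_on :: "'a set \<Rightarrow> 'a pmf \<Rightarrow> bool" where
  "dyadic_on A p \<longleftrightarrow> set_pmf p \<subseteq> A \<and> (\<forall>x\<in>A. \<exists>l::nat. pmf p x = (1/2) ^ l)"

text \<open>
  Geometric Huffman coding may discard symbols, which amounts to admitting \<open>l = \<infinity>\<close>.
\<close>

definition dyadic_or_zero_on :: "'a set \<Rightarrow> 'a pmf \<Rightarrow> bool" where
  "dyadic_or_zero_on A p \<longleftrightarrow>
     set_pmf p \<subseteq> A \<and> (\<forall>x\<in>A. pmf p x = 0 \<or> (\<exists>l::nat. pmf p x = (1/2) ^ l))"

text \<open>
  \<open>is_ghc P p' p\<close>: \<open>p\<close> is an output of geometric Huffman coding for the target \<open>p'\<close>, where
  \<open>P\<close> is the class of admissible dyadic PMFs. Optimal approximations need not be unique.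
\<close>

definition is_ghc :: "('a pmf \<Rightarrow> bool) \<Rightarrow> 'a pmf \<Rightarrow> 'a pmf \<Rightarrow> bool" where
  "is_ghc P p' p \<longleftrightarrow> is_arg_min (\<lambda>q. kl_dist q p') P p"

end

theory Submission
  imports Defs
begin

text \<open>
  Rounding the target probabilities to powers of 1/2 gives a dyadic PMF whose divergence from
  \<open>p^n\<close> is \<open>o(n)\<close>, so the optimal PMF \<open>q\<close> satisfies \<open>D(q || p^n) / n \<rightarrow> 0\<close>. By the
  variational inequality \<open>E_q F \<le> D(q || p^n) + ln E_{p^n} exp F\<close>, applied to \<open>F x = t * (\<Sum>i. g (x i))\<close>
  with small \<open>t\<close>, the averages \<open>E_q (\<Sum>i. g (x i)) / n\<close> converge to \<open>E_p g\<close>; for \<open>g = |.|^2\<close> this is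
  the energy. The mutual information of the block is \<open>E_q (\<Sum>i. d (x i))\<close>, where
  \<open>d a\<close> is the divergence of the output given \<open>a\<close> from the output under \<open>p\<close>, minus
  the divergence between the block outputs under \<open>q\<close> and \<open>p^n\<close>. By data processing the latter
  is at most \<open>D(q || p^n)\<close>, and \<open>E_p d\<close> is the mutual information of \<open>p\<close>.
\<close>

section \<open>Dyadic approximation\<close>

text \<open>The least exponent whose power is at most \<open>t\<close> works: the preceding power
  still exceeds \<open>t\<close>, and for exponent 0 the assumption t \<le> 1 takes over.\<close>

lemma ex_half_power_between:
  fixes t :: real
  assumes "0 < t" "t \<le> 1"
  shows "\<exists>l::nat. (1/2)^l \<le> t \<and> t < 2 * (1/2)^l"
proof -
  obtain n where n: "(1/2)^n < t" using real_arch_pow_inv[of t "1/2"] assms by auto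
  define l where "l = (LEAST l. (1/2)^l \<le> t)"
  have 1: "(1/2)^l \<le> t"
    unfolding l_def by (rule LeastI[of _ n]) (use n in auto)
  have "t < 2 * (1/2)^l"
  proof (cases l)
    case 0
    then show ?thesis using assms by simp
  next
    case (Suc k)
    then have "\<not> (1/2)^k \<le> t" using not_less_Least[of k "\<lambda>l. (1/2)^l \<le> t"] by (simp add: l_def)
    then show ?thesis using Suc by simp
  qed
  with 1 show ?thesis by blast
qed

text \<open>
  A Kraft sum below 1 is a multiple of the smallest weight, so doubling that weight keeps the
  sum at most 1.
\<close>

lemma kraft_completion:
  fixes l :: "'a \<Rightarrow> nat"
  assumes "finite I" "I \<noteq> {}" "(\<Sum>i\<in>I. (1/2)^l i) \<le> (1::real)"
  shows "\<exists>l'. (\<forall>i\<in>I. l' i \<le> l i) \<and> (\<Sum>i\<in>I. (1/2)^l' i) = (1::real)"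
  using assms(3)
proof (induction "sum l I" arbitrary: l rule: less_induct)
  case less
  show ?case
  proof (cases "(\<Sum>i\<in>I. (1/2)^l i) = (1::real)")
    case True
    then show ?thesis by blast
  next
    case False
    define L where "L = Max (l ` I)"
    have "L \<in> l ` I" unfolding L_def using assms by (intro Max_in) auto
    then obtain j where j: "j \<in> I" "l j = L" by auto
    have le: "l i \<le> L" if "i \<in> I" for i unfolding L_def using assms that by auto
    \<comment> \<open>The Kraft sum over the common denominator 2^L has the integer numerator
      \<open>N\<close>, so being below 1 means falling short by at least one unit 1 / 2^L.\<close>
    define N where "N = (\<Sum>i\<in>I. 2^(L - l i) :: nat)"
    have "(1/2)^l i = real (2^(L - l i)) / 2^L" if "i \<in> I" for i
      using le[OF that] power_add[of "2::real" "l i" "L - l i"] by (simp add: field_simps)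
    then have "(\<Sum>i\<in>I. (1/2)^l i) = (\<Sum>i\<in>I. real (2^(L - l i)) / 2^L)"
      by (intro sum.cong) auto
    also have "\<dots> = real N / 2^L" by (simp add: N_def sum_divide_distrib)
    finally have S: "(\<Sum>i\<in>I. (1/2)^l i) = real N / 2^L" .
    with False less.prems have "real N / 2^L < 1" by linarith
    then have "real N < 2^L" by simp
    then have "N < 2^L" by (metis of_nat_less_iff of_nat_numeral of_nat_power)
    then have "N + 1 \<le> 2^L" by simp
    from of_nat_mono[OF this, where 'a = real] have N1: "real N + 1 \<le> 2^L" by simp
    \<comment> \<open>The term of \<open>j\<close> in \<open>N\<close> equals 1. Hence N > 0, which
      together with N < 2^L excludes L = 0 and makes \<open>L - 1\<close> a genuine
      decrement.\<close>
    have "2^(L - l j) \<le> N"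
      unfolding N_def by (intro member_le_sum j(1) assms(1)) simp
    then have "0 < N" using j(2) by simp
    with \<open>N < 2^L\<close> have L0: "L > 0" by (intro gr0I) simp
    define l2 where "l2 = l(j := L - 1)"
    have "(\<Sum>i\<in>I. (1/2)^l2 i) = (1/2)^(L-1) + (\<Sum>i\<in>I-{j}. (1/2)^l i :: real)"
      unfolding l2_def using j assms(1) by (subst sum.remove[of I j]) auto
    also have "\<dots> = (1/2)^(L-1) + (real N / 2^L - (1/2)^L)"
      using S j assms(1) sum.remove[of I j "\<lambda>i. (1/2)^l i :: real"] by simp
    also have "\<dots> = (real N + 1) / 2^L" using L0 by (cases L) (auto simp: field_simps)
    also have "\<dots> \<le> 1" using N1 by simp
    finally have le1: "(\<Sum>i\<in>I. (1/2)^l2 i) \<le> (1::real)" .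
    have "sum l2 I < sum l I"
      using assms(1) j L0 by (intro sum_strict_mono_ex1) (auto simp: l2_def)
    from less.hyps[OF this le1] obtain l' where l': "\<forall>i\<in>I. l' i \<le> l2 i"
        "(\<Sum>i\<in>I. (1/2)^l' i) = (1::real)"
      by blast
    have "l2 i \<le> l i" for i by (simp add: l2_def j(2))
    with l'(1) have "\<forall>i\<in>I. l' i \<le> l i" using le_trans by blast
    with l'(2) show ?thesis by blast
  qed
qed

lemma ex_pmf_of_finite_sum:
  fixes f :: "'a \<Rightarrow> real"
  assumes "finite I" "\<And>i. i \<in> I \<Longrightarrow> 0 < f i" "sum f I = 1"
  shows "\<exists>q. set_pmf q = I \<and> (\<forall>i\<in>I. pmf q i = f i)"
proof -
  define g where "g i = (if i \<in> I then f i else 0)" for i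
  have nn: "0 \<le> g i" for i using assms(2)[of i] by (auto simp: g_def)
  have "(\<integral>\<^sup>+i. ennreal (g i) \<partial>count_space UNIV) = (\<Sum>i\<in>I. ennreal (g i))"
    using assms(1) by (intro nn_integral_count_space') (auto simp: g_def)
  also have "\<dots> = ennreal (sum g I)" using nn by simp
  also have "sum g I = 1" using assms(3) by (simp add: g_def)
  finally have 1: "(\<integral>\<^sup>+i. ennreal (g i) \<partial>count_space UNIV) = 1" by simp
  have pm: "pmf (embed_pmf g) i = g i" for i using nn 1 by (rule pmf_embed_pmf)
  have "set_pmf (embed_pmf g) = I"
    using assms(2) by (force simp: set_pmf_eq pm g_def)
  with pm show ?thesis by (intro exI[of _ "embed_pmf g"]) (auto simp: g_def)
qed

text \<open>Take an admissible \<open>J\<close> of greatest cardinality. It is not all of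
  \<open>I\<close>, because doubling everything overshoots 1; adding any missing element, of weight
  at most \<open>b\<close>, also overshoots, so the remaining gap is below \<open>b\<close>.\<close>

lemma ex_maximal_doubling:
  fixes a :: "'a \<Rightarrow> real"
  assumes "finite I" "\<And>i. i \<in> I \<Longrightarrow> a i \<le> b" "sum a I \<le> 1" "1 < 2 * sum a I"
  shows "\<exists>J\<subseteq>I. sum a I + sum a J \<le> 1 \<and> 1 - (sum a I + sum a J) < b"
proof -
  let ?P = "\<lambda>J. J \<subseteq> I \<and> sum a I + sum a J \<le> 1"
  have "?P {}" using assms by simp
  moreover have "\<forall>J. ?P J \<longrightarrow> card J < Suc (card I)"
    using assms(1) by (simp add: card_mono less_Suc_eq_le)
  ultimately obtain J where J: "?P J" and max: "\<And>K. ?P K \<Longrightarrow> card K \<le> card J"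
    using ex_has_greatest_nat[of ?P "{}" card "Suc (card I)"] by (metis (no_types, lifting) le_less)
  have "J \<noteq> I" using J assms(4) by auto
  then obtain j where j: "j \<in> I" "j \<notin> J" using J by blast
  have fJ: "finite J" using J assms(1) finite_subset by blast
  have "\<not> ?P (insert j J)" using max[of "insert j J"] j fJ by auto
  then have "1 < sum a I + (a j + sum a J)" using J j fJ by auto
  then show ?thesis using J assms(2)[OF j(1)] by (intro exI[of _ J]) auto
qed

text \<open>
  Round down, double as many weights as the sum allows, then complete to sum 1. A weight that the
  completion leaves alone is at most twice its target and costs at most 1 bit per unit mass; the
  others have mass at most twice the deficit that remained after doubling, which is below \<open>b\<close>.
\<close>

lemma ex_dyadic_approximation:
  fixes t :: "'a pmf"
  assumes fin: "finite (set_pmf t)"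
    and m: "0 < m" "\<And>x. x \<in> set_pmf t \<Longrightarrow> m \<le> pmf t x"
    and b: "\<And>x. x \<in> set_pmf t \<Longrightarrow> pmf t x \<le> b"
  shows "\<exists>q. set_pmf q = set_pmf t \<and> dyadic_on (set_pmf t) q \<and>
           kl_dist q t \<le> ereal (1 + 2 * b * log 2 (1/m))"
proof -
  define I where "I = set_pmf t"
  note fin = fin[folded I_def] and m = m[folded I_def] and b = b[folded I_def]
  have tpos: "0 < pmf t x" if "x \<in> I" for x using that by (simp add: I_def pmf_positive)
  have tsum: "sum (pmf t) I = 1" unfolding I_def using assms(1) by (intro sum_pmf_eq_1) auto
  have I0: "I \<noteq> {}" by (simp add: I_def set_pmf_not_empty)
  have "\<forall>x. \<exists>l::nat. x \<in> I \<longrightarrow> (1/2)^l \<le> pmf t x \<and> pmf t x < 2 * (1/2)^l"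
    using tpos ex_half_power_between pmf_le_1 by metis
  then obtain l :: "'a \<Rightarrow> nat" where l: "\<And>x. x \<in> I \<Longrightarrow> (1/2)^l x \<le> pmf t x"
      "\<And>x. x \<in> I \<Longrightarrow> pmf t x < 2 * (1/2)^l x"
    by metis
  define a where "a x = (1/2::real)^l x" for x
  have apos: "0 < a x" for x by (simp add: a_def)
  have ab: "a x \<le> b" if "x \<in> I" for x using l(1) b that unfolding a_def by fastforce
  have "sum a I \<le> 1" using l(1) tsum sum_mono[of I a "pmf t"] by (simp add: a_def)
  moreover have "sum (pmf t) I < (\<Sum>x\<in>I. 2 * a x)"
    using fin I0 l(2) by (intro sum_strict_mono) (auto simp: a_def)
  then have "1 < 2 * sum a I" using tsum by (simp add: sum_distrib_left)
  ultimately obtain J where J: "J \<subseteq> I" "sum a I + sum a J \<le> 1" "1 - (sum a I + sum a J) < b"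
    using ex_maximal_doubling[of I a b] fin ab by blast
  \<comment> \<open>A weight 1 in \<open>J\<close> would count in both sums and give at least 2. So
    the exponents on \<open>J\<close> are positive and doubling is a decrement on the
    naturals.\<close>
  have lJ: "0 < l x" if "x \<in> J" for x
  proof (rule ccontr)
    assume "\<not> 0 < l x"
    then have "a x = 1" by (simp add: a_def)
    moreover have "a x \<le> sum a J" "a x \<le> sum a I"
      using that J(1) fin finite_subset[OF J(1) fin] apos
      by (auto intro!: member_le_sum simp: less_imp_le)
    ultimately show False using J(2) by simp
  qed
  define k where "k x = (if x \<in> J then l x - 1 else l x)" for x
  define c where "c x = (1/2::real)^k x" for x
  have c: "c x = (if x \<in> J then 2 * a x else a x)" for x
    using lJ[of x] by (cases "l x") (auto simp: c_def k_def a_def)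
  have "sum c I = (\<Sum>x\<in>I. a x + (if x \<in> J then a x else 0))"
    by (intro sum.cong) (auto simp: c)
  also have "\<dots> = sum a I + sum a J"
    using J(1) fin by (simp add: sum.distrib sum.inter_restrict[symmetric] Int_absorb1)
  finally have csum: "sum c I = sum a I + sum a J" .
  then obtain l' where l': "\<And>x. x \<in> I \<Longrightarrow> l' x \<le> k x" "(\<Sum>x\<in>I. (1/2)^l' x) = (1::real)"
    using kraft_completion[of I k] fin I0 J(2) by (auto simp: c_def)
  obtain q where q: "set_pmf q = I" "\<And>x. x \<in> I \<Longrightarrow> pmf q x = (1/2)^l' x"
    using ex_pmf_of_finite_sum[of I "\<lambda>x. (1/2)^l' x"] fin l'(2) by auto
  have qsum: "sum (pmf q) I = 1" using l'(2) q(2) by simp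
  have m1: "m \<le> 1" using I0 m(2) pmf_le_1 by (meson ex_in_conv order_trans)
  then have lm: "0 \<le> log 2 (1/m)" using m(1) by simp
  \<comment> \<open>Here \<open>pmf q x - c x\<close> is the mass that the completion adds at
    \<open>x\<close>. Where it changes an exponent, the weight at least doubles, so
    \<open>pmf q x\<close> is at most twice the added mass, and the log ratio is bounded crudely by
    log(1/m).\<close>
  have cost: "pmf q x * log 2 (pmf q x / pmf t x) \<le> pmf q x + 2 * (pmf q x - c x) * log 2 (1/m)"
    if x: "x \<in> I" for x
  proof (cases "l' x = k x")
    case True
    then have qc: "pmf q x = c x" using q(2) x by (simp add: c_def)
    have "pmf q x \<le> 2 * pmf t x" unfolding qc using l(1)[OF x] tpos[OF x] by (auto simp: c a_def)
    then have "pmf q x / pmf t x \<le> 2 powr 1" using tpos[OF x] by (simp add: field_simps)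
    then have "log 2 (pmf q x / pmf t x) \<le> 1"
      using tpos[OF x] q(2)[OF x] by (subst log_le_iff) auto
    then have "pmf q x * log 2 (pmf q x / pmf t x) \<le> pmf q x * 1"
      by (intro mult_left_mono) auto
    then show ?thesis using qc by simp
  next
    case False
    then have "Suc (l' x) \<le> k x" using l'(1)[OF x] by simp
    then have "(1/2::real)^k x \<le> (1/2)^Suc (l' x)" by (intro power_decreasing) auto
    then have q2: "pmf q x \<le> 2 * (pmf q x - c x)" using q(2)[OF x] by (simp add: c_def)
    have "pmf q x / pmf t x \<le> 1 / m"
      using m x tpos[OF x] pmf_le_1[of q x] by (intro frac_le) auto
    then have "log 2 (pmf q x / pmf t x) \<le> log 2 (1/m)"
      using tpos[OF x] q(2)[OF x] m(1) by (subst log_le_cancel_iff) auto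
    then have "pmf q x * log 2 (pmf q x / pmf t x) \<le> pmf q x * log 2 (1/m)"
      by (intro mult_left_mono) auto
    also have "\<dots> \<le> 2 * (pmf q x - c x) * log 2 (1/m)" using q2 lm by (intro mult_right_mono)
    finally show ?thesis by (smt (verit) pmf_nonneg)
  qed
  have "(\<Sum>x\<in>I. pmf q x * log 2 (pmf q x / pmf t x))
      \<le> (\<Sum>x\<in>I. pmf q x + 2 * (pmf q x - c x) * log 2 (1/m))"
    by (intro sum_mono cost)
  also have "\<dots> = 1 + 2 * (1 - sum c I) * log 2 (1/m)"
    using qsum by (simp add: sum.distrib sum_subtractf flip: sum_distrib_left sum_distrib_right)
  also have "\<dots> \<le> 1 + 2 * b * log 2 (1/m)"
    using J(3) lm csum by (intro add_left_mono mult_right_mono) auto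
  finally have "kl_dist q t \<le> ereal (1 + 2 * b * log 2 (1/m))"
    using q(1) by (simp add: kl_dist_def I_def)
  moreover have "dyadic_on I q" using q by (auto simp: dyadic_on_def)
  ultimately show ?thesis using q(1) unfolding I_def by blast
qed

section \<open>Averages under a vanishing divergence rate\<close>

text \<open>By concavity the logarithm lies below its tangent at \<open>y\<close>. This is the form
  in which every divergence inequality below uses convexity.\<close>

lemma ln_le_of_pos:
  fixes x y :: real
  assumes "0 < x" "0 < y"
  shows "ln x \<le> x / y - 1 + ln y"
  using ln_le_minus_one[of "x / y"] assms by (simp add: ln_div)

text \<open>The Donsker-Varadhan inequality on a finite space. The tangent of the logarithm at the
  normalizer \<open>Z\<close> bounds each term; on summation, the tilted weights on the support of
  \<open>q\<close> have total at most \<open>Z\<close>.\<close>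

lemma gibbs_variational:
  fixes P :: "'a pmf" and F :: "'a \<Rightarrow> real"
  assumes fin: "finite (set_pmf P)" and sub: "set_pmf q \<subseteq> set_pmf P"
  shows "(\<Sum>x\<in>set_pmf P. pmf q x * F x) \<le>
     (\<Sum>x\<in>set_pmf q. pmf q x * ln (pmf q x / pmf P x)) + ln (\<Sum>x\<in>set_pmf P. pmf P x * exp (F x))"
proof -
  define Z where "Z = (\<Sum>x\<in>set_pmf P. pmf P x * exp (F x))"
  have finq: "finite (set_pmf q)" using fin sub finite_subset by blast
  have Z: "0 < Z" unfolding Z_def using fin set_pmf_not_empty
    by (intro sum_pos) (auto simp: pmf_positive)
  have pointwise: "pmf q x * F x - pmf q x * ln (pmf q x / pmf P x)
      \<le> pmf P x * exp (F x) / Z + pmf q x * (ln Z - 1)" if x: "x \<in> set_pmf q" for x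
  proof -
    have pos: "0 < pmf q x" "0 < pmf P x" using x sub by (auto simp: pmf_positive)
    have "F x - ln (pmf q x / pmf P x) = ln (pmf P x * exp (F x) / pmf q x)"
      using pos by (simp add: ln_div ln_mult)
    also have "\<dots> \<le> pmf P x * exp (F x) / pmf q x / Z - 1 + ln Z"
      using pos Z by (intro ln_le_of_pos) auto
    finally have "pmf q x * (F x - ln (pmf q x / pmf P x))
        \<le> pmf q x * (pmf P x * exp (F x) / pmf q x / Z - 1 + ln Z)"
      using pos by (intro mult_left_mono) auto
    then show ?thesis using pos by (simp add: algebra_simps)
  qed
  have "(\<Sum>x\<in>set_pmf P. pmf q x * F x) = (\<Sum>x\<in>set_pmf q. pmf q x * F x)"
    using fin sub by (intro sum.mono_neutral_right) (auto simp: set_pmf_iff)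
  moreover have "(\<Sum>x\<in>set_pmf q. pmf q x * F x) - (\<Sum>x\<in>set_pmf q. pmf q x * ln (pmf q x / pmf P x))
      \<le> (\<Sum>x\<in>set_pmf q. pmf P x * exp (F x) / Z + pmf q x * (ln Z - 1))"
    unfolding sum_subtractf[symmetric] by (intro sum_mono pointwise)
  moreover have "\<dots> = (\<Sum>x\<in>set_pmf q. pmf P x * exp (F x)) / Z + (ln Z - 1)"
    using finq by (simp add: sum.distrib sum_pmf_eq_1 flip: sum_distrib_right sum_divide_distrib)
  moreover have "(\<Sum>x\<in>set_pmf q. pmf P x * exp (F x)) \<le> Z"
    unfolding Z_def using fin sub by (intro sum_mono2) auto
  then have "(\<Sum>x\<in>set_pmf q. pmf P x * exp (F x)) / Z \<le> 1" using Z by simp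
  ultimately show ?thesis unfolding Z_def by linarith
qed

section \<open>Blocks of independent letters and their exponential moments\<close>

text \<open>The default value \<open>undefined\<close> of the product PMF outside {..<n} matches the
  extensional functions that serve as blocks.\<close>

lemma set_iid_pmf: "set_pmf (iid_pmf n p) = blocks n (set_pmf p)"
  by (auto simp: iid_pmf_def set_Pi_pmf PiE_dflt_def blocks_def PiE_def extensional_def Pi_def)

lemma finite_blocks: "finite A \<Longrightarrow> finite (blocks n A)"
  by (simp add: blocks_def finite_PiE)

lemma pmf_iid:
  "x \<in> blocks n A \<Longrightarrow> pmf (iid_pmf n p) x = (\<Prod>i<n. pmf p (x i))"
  unfolding iid_pmf_def blocks_def by (subst pmf_Pi') (auto simp: PiE_def extensional_def)

lemma sum_blocks_prod:
  fixes f :: "nat \<Rightarrow> 'a \<Rightarrow> 'c :: comm_semiring_1"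
  shows "finite A \<Longrightarrow> (\<Sum>x\<in>blocks n A. \<Prod>i<n. f i (x i)) = (\<Prod>i<n. \<Sum>a\<in>A. f i a)"
  unfolding blocks_def by (rule prod_sum_PiE[symmetric]) auto

text \<open>By independence the exponential moment of an additive function factors, so the cumulant
  of the block is exactly \<open>n\<close> times that of one letter.\<close>

lemma expectation_iid_exp:
  fixes g :: "'a \<Rightarrow> real"
  assumes "finite (set_pmf p)"
  shows "(\<Sum>x\<in>blocks n (set_pmf p). pmf (iid_pmf n p) x * exp (\<Sum>i<n. g (x i)))
     = (\<Sum>a\<in>set_pmf p. pmf p a * exp (g a)) ^ n"
proof -
  have "(\<Sum>x\<in>blocks n (set_pmf p). pmf (iid_pmf n p) x * exp (\<Sum>i<n. g (x i)))
     = (\<Sum>x\<in>blocks n (set_pmf p). \<Prod>i<n. pmf p (x i) * exp (g (x i)))"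
    by (intro sum.cong) (auto simp: pmf_iid exp_sum prod.distrib)
  also have "\<dots> = (\<Prod>i<n. \<Sum>a\<in>set_pmf p. pmf p a * exp (g a))"
    using assms by (rule sum_blocks_prod)
  finally show ?thesis by simp
qed

text \<open>The slope of the cumulant generating function at 0 is the mean; it identifies the limit
  of the averages when the tilt is small.\<close>

lemma log_sum_exp_derivative:
  fixes g :: "'a \<Rightarrow> real"
  assumes "finite (set_pmf p)"
  shows "((\<lambda>t. ln (\<Sum>a\<in>set_pmf p. pmf p a * exp (t * g a))) has_real_derivative
      (\<Sum>a\<in>set_pmf p. pmf p a * g a)) (at 0)"
  using assms by (auto intro!: derivative_eq_intros simp: sum_pmf_eq_1 mult.commute)

text \<open>The variational inequality for the tilt \<open>t * g\<close>, divided by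
  \<open>n * t\<close>, bounds the average by D / (n t) + f(t) / t. The second term is close to the
  mean for small \<open>t\<close>, and for fixed \<open>t\<close> the first vanishes as
  \<open>n\<close> grows.\<close>

lemma averages_upper_limit:
  fixes p :: "'a pmf" and g :: "'a \<Rightarrow> real"
  assumes fin: "finite (set_pmf p)"
    and sub: "\<And>n. n \<ge> 1 \<Longrightarrow> set_pmf (q n) \<subseteq> blocks n (set_pmf p)"
    and lim: "(\<lambda>n. (\<Sum>x\<in>set_pmf (q n). pmf (q n) x * ln (pmf (q n) x / pmf (iid_pmf n p) x)) / n)
       \<longlonglongrightarrow> 0"
    and e: "(\<Sum>a\<in>set_pmf p. pmf p a * g a) < e"
  shows "eventually (\<lambda>n. (\<Sum>x\<in>blocks n (set_pmf p). pmf (q n) x * (\<Sum>i<n. g (x i))) / n < e)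
     sequentially"
proof -
  let ?D = "\<lambda>n. (\<Sum>x\<in>set_pmf (q n). pmf (q n) x * ln (pmf (q n) x / pmf (iid_pmf n p) x))"
  let ?m = "\<Sum>a\<in>set_pmf p. pmf p a * g a"
  define f where "f t = ln (\<Sum>a\<in>set_pmf p. pmf p a * exp (t * g a))" for t
  have f0: "f 0 = 0" using fin by (simp add: f_def sum_pmf_eq_1)
  have "((\<lambda>t. f t / t) \<longlongrightarrow> ?m) (at 0)"
    using log_sum_exp_derivative[OF fin, of g] unfolding DERIV_def f_def[symmetric] by (simp add: f0)
  then have "((\<lambda>t. f t / t) \<longlongrightarrow> ?m) (at_right 0)"
    by (rule filterlim_mono) (auto intro: at_le)
  then have "eventually (\<lambda>t. f t / t < e) (at_right 0)" using e by (rule order_tendstoD)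
  then have "eventually (\<lambda>t. f t / t < e \<and> 0 < t) (at_right 0)"
    by (auto intro: eventually_conj simp: eventually_at_right_less)
  \<comment> \<open>The tilt is fixed before \<open>n\<close>, so dividing the divergence rate by it
    does not spoil the convergence to 0.\<close>
  then obtain t where t: "f t / t < e" "0 < t"
    using eventually_happens'[OF trivial_limit_at_right_real] by blast
  have "(\<lambda>n. ?D n / n / t + f t / t) \<longlonglongrightarrow> 0 / t + f t / t"
    using t by (intro tendsto_intros lim) auto
  then have "eventually (\<lambda>n. ?D n / n / t + f t / t < e) sequentially"
    using t by (intro order_tendstoD(2)) auto
  then show ?thesis
    using eventually_ge_at_top[of 1]
  proof eventually_elim
    case (elim n)
    let ?S = "\<Sum>x\<in>blocks n (set_pmf p). pmf (q n) x * (\<Sum>i<n. g (x i))"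
    have "(\<Sum>x\<in>set_pmf (iid_pmf n p). pmf (q n) x * (\<Sum>i<n. t * g (x i)))
        \<le> ?D n + ln (\<Sum>x\<in>set_pmf (iid_pmf n p). pmf (iid_pmf n p) x * exp (\<Sum>i<n. t * g (x i)))"
      using fin sub elim by (intro gibbs_variational) (auto simp: set_iid_pmf finite_blocks)
    also have "\<dots> = ?D n + n * f t"
      unfolding set_iid_pmf expectation_iid_exp[OF fin, where g = "\<lambda>a. t * g a"] f_def
      using fin set_pmf_not_empty
      by (subst ln_realpow) (auto intro!: sum_pos simp: pmf_positive)
    also have "(\<Sum>x\<in>set_pmf (iid_pmf n p). pmf (q n) x * (\<Sum>i<n. t * g (x i))) = t * ?S"
      by (simp add: set_iid_pmf sum_distrib_left mult_ac)
    finally have "?S / n \<le> ?D n / n / t + f t / t" using t elim(2) by (simp add: field_simps)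
    then show ?case using elim(1) by simp
  qed
qed

lemma averages_tendsto:
  fixes p :: "'a pmf" and g :: "'a \<Rightarrow> real"
  assumes "finite (set_pmf p)"
    and "\<And>n. n \<ge> 1 \<Longrightarrow> set_pmf (q n) \<subseteq> blocks n (set_pmf p)"
    and "(\<lambda>n. (\<Sum>x\<in>set_pmf (q n). pmf (q n) x * ln (pmf (q n) x / pmf (iid_pmf n p) x)) / n)
       \<longlonglongrightarrow> 0"
  shows "(\<lambda>n. (\<Sum>x\<in>blocks n (set_pmf p). pmf (q n) x * (\<Sum>i<n. g (x i))) / n)
     \<longlonglongrightarrow> (\<Sum>a\<in>set_pmf p. pmf p a * g a)"
proof (rule order_tendstoI)
  fix e assume "e < (\<Sum>a\<in>set_pmf p. pmf p a * g a)"
  then have "(\<Sum>a\<in>set_pmf p. pmf p a * - g a) < - e" by (simp add: sum_negf)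
  from averages_upper_limit[where q=q, OF assms this]
  show "eventually (\<lambda>n. e < (\<Sum>x\<in>blocks n (set_pmf p). pmf (q n) x * (\<Sum>i<n. g (x i))) / n)
     sequentially"
    by (simp add: sum_negf)
next
  fix e assume "(\<Sum>a\<in>set_pmf p. pmf p a * g a) < e"
  from averages_upper_limit[where q=q, OF assms this]
  show "eventually (\<lambda>n. (\<Sum>x\<in>blocks n (set_pmf p). pmf (q n) x * (\<Sum>i<n. g (x i))) / n < e)
     sequentially" .
qed

text \<open>
  The largest block probability decays geometrically unless \<open>p\<close> is a point mass, and in that
  case the logarithmic factor vanishes.
\<close>

lemma ghc_divergence:
  fixes p :: "'a pmf"
  assumes fin: "finite (set_pmf p)" and sub: "set_pmf p \<subseteq> X"
    and ghc: "(\<forall>n\<ge>1. is_ghc (dyadic_or_zero_on (blocks n X)) (iid_pmf n p) (q n)) \<or>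
         (\<forall>n\<ge>1. is_ghc (dyadic_on (blocks n (set_pmf p))) (iid_pmf n p) (q n))"
  shows "\<exists>\<epsilon>. (\<epsilon> \<longlonglongrightarrow> (0::real)) \<and> (\<forall>n\<ge>1. kl_dist (q n) (iid_pmf n p) \<le> ereal (real n * \<epsilon> n))"
proof -
  define m where "m = Min (pmf p ` set_pmf p)"
  define b where "b = Max (pmf p ` set_pmf p)"
  have m: "m \<in> pmf p ` set_pmf p" "\<And>a. a \<in> set_pmf p \<Longrightarrow> m \<le> pmf p a"
    unfolding m_def using fin set_pmf_not_empty by (auto intro!: Min_in)
  have b: "b \<in> pmf p ` set_pmf p" "\<And>a. a \<in> set_pmf p \<Longrightarrow> pmf p a \<le> b"
    unfolding b_def using fin set_pmf_not_empty by (auto intro!: Max_in)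
  have m0: "0 < m" using m(1) by (auto simp: pmf_positive)
  have b0: "0 \<le> b" "b \<le> 1" using b(1) by (auto simp: pmf_le_1)
  \<comment> \<open>The cost of the dyadic approximation per letter: block probabilities lie between
    m^n and b^n, the rounding bit contributes 1/n, and log(1/m^n) = n log(1/m) absorbs the division
    by \<open>n\<close>.\<close>
  define \<epsilon> where "\<epsilon> n = 1 / real n + 2 * b ^ n * log 2 (1/m)" for n
  have "(\<lambda>n. 2 * b ^ n * log 2 (1/m)) \<longlonglongrightarrow> 0"
  proof (cases "b = 1")
    case True
    then obtain a where a: "a \<in> set_pmf p" "pmf p a = 1" using b(1) by auto
    have "set_pmf p = {a}"
    proof (rule ccontr)
      assume "set_pmf p \<noteq> {a}"
      then obtain c where c: "c \<in> set_pmf p" "c \<noteq> a" using a by auto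
      have "sum (pmf p) {a, c} \<le> sum (pmf p) (set_pmf p)"
        using a c fin by (intro sum_mono2) auto
      then show False using a c fin pmf_positive[OF c(1)] by (simp add: sum_pmf_eq_1)
    qed
    then have "m = 1" using a by (simp add: m_def)
    then show ?thesis by simp
  next
    case False
    then have "(\<lambda>n. 2 * b ^ n * log 2 (1/m)) \<longlonglongrightarrow> 2 * 0 * log 2 (1/m)"
      using b0 by (intro tendsto_intros LIMSEQ_realpow_zero) auto
    then show ?thesis by simp
  qed
  then have "\<epsilon> \<longlonglongrightarrow> 0 + 0"
    unfolding \<epsilon>_def by (intro tendsto_add lim_1_over_n)
  moreover have "kl_dist (q n) (iid_pmf n p) \<le> ereal (real n * \<epsilon> n)" if n: "n \<ge> 1" for n
  proof -
    let ?t = "iid_pmf n p"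
    have bounds: "m ^ n \<le> pmf ?t x \<and> pmf ?t x \<le> b ^ n" if "x \<in> set_pmf ?t" for x
    proof -
      have x: "x \<in> blocks n (set_pmf p)" using that by (simp add: set_iid_pmf)
      then have "x i \<in> set_pmf p" if "i < n" for i using that by (auto simp: blocks_def)
      then show ?thesis
        using prod_mono[of "{..<n}" "\<lambda>_. m" "\<lambda>i. pmf p (x i)"]
          prod_mono[of "{..<n}" "\<lambda>i. pmf p (x i)" "\<lambda>_. b"] m(2) b(2) m0
        by (simp add: pmf_iid[OF x] less_imp_le)
    qed
    obtain d where d: "set_pmf d = set_pmf ?t" "dyadic_on (set_pmf ?t) d"
        "kl_dist d ?t \<le> ereal (1 + 2 * b ^ n * log 2 (1 / m ^ n))"
      using ex_dyadic_approximation[of ?t "m ^ n" "b ^ n"] bounds fin m0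
      by (auto simp: set_iid_pmf finite_blocks)
    \<comment> \<open>The approximation competes in both classes: it is dyadic on the blocks over
      the support of \<open>p\<close>, and where zeros are allowed it is zero on the other blocks
      over \<open>X\<close>.\<close>
    have d2: "dyadic_on (blocks n (set_pmf p)) d" using d(2) by (simp add: set_iid_pmf)
    have "blocks n (set_pmf p) \<subseteq> blocks n X" using sub by (auto simp: blocks_def)
    then have "dyadic_or_zero_on (blocks n X) d"
      using d2 unfolding dyadic_on_def dyadic_or_zero_on_def set_pmf_iff subset_iff by metis
    then have "kl_dist (q n) ?t \<le> kl_dist d ?t"
      using ghc n d2 by (auto simp: is_ghc_def is_arg_min_def not_less)
    also note d(3)
    also have "1 + 2 * b ^ n * log 2 (1 / m ^ n) = real n * \<epsilon> n"
      using n m0 by (simp add: \<epsilon>_def log_divide log_nat_power field_simps)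
    finally show ?thesis .
  qed
  ultimately show ?thesis by auto
qed

text \<open>A real bound on the extended divergence also carries the inclusion of supports, which is
  how the supports of the optimal PMFs are controlled.\<close>

lemma kl_dist_le_ereal_iff:
  "kl_dist q t \<le> ereal c \<longleftrightarrow>
     set_pmf q \<subseteq> set_pmf t \<and> (\<Sum>x\<in>set_pmf q. pmf q x * log 2 (pmf q x / pmf t x)) \<le> c"
  by (simp add: kl_dist_def)

section \<open>Mutual information relative to a reference input\<close>

text \<open>The lower bound is monotonicity of the logarithm, the upper one its tangent at
  \<open>f\<close>. At f = 0 the product with the logarithm is 0.\<close>

lemma cross_entropy_pointwise:
  fixes f g c :: real
  assumes "0 \<le> f" "0 < c" "c * f \<le> g"
  shows "f * ln f + ln c * f \<le> f * ln g" "f * ln g \<le> f * ln f + (g - f)"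
proof -
  have "f * ln f + ln c * f \<le> f * ln g \<and> f * ln g \<le> f * ln f + (g - f)"
  proof (cases "f = 0")
    case True
    then show ?thesis using assms by simp
  next
    case False
    then have f: "0 < f" using assms by simp
    then have cf: "0 < c * f" using assms by simp
    then have "ln (c * f) \<le> ln g" using assms(3) by (subst ln_le_cancel_iff) auto
    then have "f * (ln c + ln f) \<le> f * ln g"
      using f assms(2) by (intro mult_left_mono) (auto simp: ln_mult)
    moreover have "f * ln g \<le> f * (g / f - 1 + ln f)"
      using f cf assms(3) by (intro mult_left_mono ln_le_of_pos) auto
    ultimately show ?thesis using f by (simp add: algebra_simps)
  qed
  then show "f * ln f + ln c * f \<le> f * ln g" "f * ln g \<le> f * ln f + (g - f)" by auto
qed

lemma integrable_cross_entropy: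
  fixes f g :: "'b \<Rightarrow> real"
  assumes "\<And>y. 0 \<le> f y" "0 < c" "\<And>y. c * f y \<le> g y"
    and [measurable]: "integrable M f" "integrable M g" and "integrable M (\<lambda>y. f y * ln (f y))"
  shows "integrable M (\<lambda>y. f y * ln (g y))"
proof (rule Bochner_Integration.integrable_bound)
  \<comment> \<open>The dominating function adds the absolute values of the two pointwise
    bounds.\<close>
  show "integrable M (\<lambda>y. \<bar>f y * ln (f y) + ln c * f y\<bar> + \<bar>f y * ln (f y) + (g y - f y)\<bar>)"
    using assms by (intro integrable_abs Bochner_Integration.integrable_add
        Bochner_Integration.integrable_diff integrable_mult_right) auto
  have [measurable]: "f \<in> borel_measurable M" "g \<in> borel_measurable M" using assms by auto
  show "(\<lambda>y. f y * ln (g y)) \<in> borel_measurable M" by measurable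
  show "AE y in M. norm (f y * ln (g y))
      \<le> norm (\<bar>f y * ln (f y) + ln c * f y\<bar> + \<bar>f y * ln (f y) + (g y - f y)\<bar>)"
  proof (rule AE_I2)
    fix y
    show "norm (f y * ln (g y))
      \<le> norm (\<bar>f y * ln (f y) + ln c * f y\<bar> + \<bar>f y * ln (f y) + (g y - f y)\<bar>)"
      using cross_entropy_pointwise[OF assms(1,2,3), of y] unfolding real_norm_def by linarith
  qed
qed

lemma mutual_info_ln:
  fixes M :: "'b measure"
  shows "ln 2 * mutual_info M A W p =
     - (\<integral>y. output_density A W p y * ln (output_density A W p y) \<partial>M)
     + (\<Sum>x\<in>A. pmf p x * (\<integral>y. W x y * ln (W x y) \<partial>M))"
proof -
  have "ln 2 * (\<integral>y. f y * log 2 (f y) \<partial>M) = (\<integral>y. f y * ln (f y) \<partial>M)" for f :: "'b \<Rightarrow> real"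
    by (simp add: log_def)
  then show ?thesis
    by (simp add: mutual_info_def right_diff_distrib sum_distrib_left mult.left_commute[of "ln 2"])
qed

text \<open>Integrability of \<open>W x y * ln (W x y)\<close> says that each conditional output has
  finite differential entropy. The conditions pass from one letter to blocks.\<close>

definition channel_on :: "'b measure \<Rightarrow> 'a set \<Rightarrow> ('a \<Rightarrow> 'b \<Rightarrow> real) \<Rightarrow> bool" where
  "channel_on M A W \<longleftrightarrow> finite A \<and>
     (\<forall>x\<in>A. (\<forall>y. 0 \<le> W x y) \<and> integrable M (W x) \<and> (\<integral>y. W x y \<partial>M) = 1 \<and>
        integrable M (\<lambda>y. W x y * ln (W x y)))"

text \<open>The divergence, in nats, of the output given \<open>x\<close> from the output under
  \<open>P\<close>, split into two integrals. It has this meaning for \<open>x\<close> in the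
  support of \<open>P\<close>; other letters get weight 0 wherever it is averaged.\<close>

definition info_density ::
  "'b measure \<Rightarrow> 'a set \<Rightarrow> ('a \<Rightarrow> 'b \<Rightarrow> real) \<Rightarrow> 'a pmf \<Rightarrow> 'a \<Rightarrow> real" where
  "info_density M A W P x =
     (\<integral>y. W x y * ln (W x y) \<partial>M) - (\<integral>y. W x y * ln (output_density A W P y) \<partial>M)"

context
  fixes M :: "'b measure" and A :: "'a set" and W :: "'a \<Rightarrow> 'b \<Rightarrow> real"
  assumes channel: "channel_on M A W"
begin

lemma output_density_ge:
  assumes "x \<in> A"
  shows "pmf p x * W x y \<le> output_density A W p y"
  unfolding output_density_def using channel assms
  by (intro member_le_sum) (auto simp: channel_on_def)

lemma output_density_nonneg: "0 \<le> output_density A W p y"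
  unfolding output_density_def using channel by (intro sum_nonneg) (auto simp: channel_on_def)

lemma output_density_integrable: "integrable M (output_density A W p)"
  unfolding output_density_def using channel
  by (intro Bochner_Integration.integrable_sum integrable_mult_right) (auto simp: channel_on_def)

lemma output_density_integral:
  assumes "set_pmf p \<subseteq> A"
  shows "(\<integral>y. output_density A W p y \<partial>M) = 1"
proof -
  have "(\<integral>y. output_density A W p y \<partial>M) = (\<Sum>x\<in>A. pmf p x)"
    unfolding output_density_def using channel
    by (subst Bochner_Integration.integral_sum) (auto simp: channel_on_def)
  then show ?thesis using assms channel by (simp add: sum_pmf_eq_1 channel_on_def)
qed

text \<open>The output density dominates \<open>W x\<close> up to the factor \<open>pmf p x\<close>,
  which is positive exactly for letters in the support.\<close>

lemma integrable_ln_output_density: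
  assumes "x \<in> A" "x \<in> set_pmf p"
  shows "integrable M (\<lambda>y. W x y * ln (output_density A W p y))"
proof (rule integrable_cross_entropy)
  show "0 < pmf p x" using assms(2) by (rule pmf_positive)
  show "pmf p x * W x y \<le> output_density A W p y" for y
    using assms(1) by (rule output_density_ge)
qed (use channel assms(1) output_density_integrable in \<open>auto simp: channel_on_def\<close>)

lemma output_cross_entropy:
  assumes "set_pmf q \<subseteq> set_pmf p"
  shows "integrable M (\<lambda>y. output_density A W q y * ln (output_density A W p y))" (is ?I)
    and "(\<integral>y. output_density A W q y * ln (output_density A W p y) \<partial>M)
       = (\<Sum>x\<in>A. pmf q x * (\<integral>y. W x y * ln (output_density A W p y) \<partial>M))" (is ?E)
proof -
  have i: "integrable M (\<lambda>y. pmf q x * (W x y * ln (output_density A W p y)))" if "x \<in> A" for x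
  proof (cases "x \<in> set_pmf q")
    case True
    then show ?thesis using that assms
      by (intro integrable_mult_right integrable_ln_output_density) auto
  next
    case False
    then show ?thesis by (simp add: set_pmf_iff)
  qed
  have e: "(\<lambda>y. output_density A W q y * ln (output_density A W p y))
      = (\<lambda>y. \<Sum>x\<in>A. pmf q x * (W x y * ln (output_density A W p y)))"
    by (simp add: output_density_def[of A W q] sum_distrib_right mult.assoc)
  show ?I unfolding e by (intro Bochner_Integration.integrable_sum i)
  show ?E unfolding e by (subst Bochner_Integration.integral_sum[OF i]) auto
qed

text \<open>
  With \<open>P\<close> as reference input, mutual information is the mean information density minus the
  divergence between the output distributions, and the latter lies between 0 and the divergence
  between the input distributions.
\<close>

lemma mutual_info_sandwich:
  assumes P: "set_pmf P \<subseteq> A" and q: "set_pmf q \<subseteq> set_pmf P"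
  shows "ln 2 * mutual_info M A W q \<le> (\<Sum>x\<in>A. pmf q x * info_density M A W P x)"
    and "(\<Sum>x\<in>A. pmf q x * info_density M A W P x)
        - (\<Sum>x\<in>set_pmf q. pmf q x * ln (pmf q x / pmf P x)) \<le> ln 2 * mutual_info M A W q"
proof -
  let ?r = "output_density A W q" and ?R = "output_density A W P"
  let ?D = "\<Sum>x\<in>A. pmf q x * ln (pmf q x / pmf P x)"
  have fin: "finite A" and W: "\<And>x y. x \<in> A \<Longrightarrow> 0 \<le> W x y"
    using channel by (auto simp: channel_on_def)
  have int: "integrable M (\<lambda>y. ?r y * ln (?r y))" "integrable M (\<lambda>y. ?r y * ln (?R y))"
    using output_cross_entropy(1) q by auto
  have lower: "?r y - ?R y \<le> ?r y * ln (?r y) - ?r y * ln (?R y)" for y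
  proof (cases "?R y = 0 \<or> ?r y = 0")
    case True
    \<comment> \<open>Absolute continuity: where the output density under \<open>P\<close> vanishes,
      so does \<open>W x y\<close> for every \<open>x\<close> in its support, hence also the output
      density under \<open>q\<close>.\<close>
    have "?r y = 0" if "?R y = 0"
    proof -
      have "pmf q x * W x y = 0" if x: "x \<in> A" for x
      proof (cases "x \<in> set_pmf q")
        case True
        then have "0 < pmf P x" using q by (auto simp: pmf_positive)
        then show ?thesis
          using output_density_ge[OF x, of P y] \<open>?R y = 0\<close> W[OF x, of y]
          by (metis mult_pos_pos less_le not_less mult_zero_right)
      qed (simp add: set_pmf_iff)
      then show ?thesis unfolding output_density_def by (intro sum.neutral ballI)
    qed
    then have "?r y = 0" using True by blast
    then show ?thesis using output_density_nonneg[of P y] by simp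
  next
    case False
    then have "0 < ?r y" "0 < ?R y"
      using output_density_nonneg[of P y] output_density_nonneg[of q y] by auto
    then have "?r y * ln (?R y) \<le> ?r y * (?R y / ?r y - 1 + ln (?r y))"
      by (intro mult_left_mono ln_le_of_pos) auto
    then show ?thesis using \<open>0 < ?r y\<close> by (simp add: algebra_simps)
  qed
  have upper: "?r y * ln (?r y) - ?r y * ln (?R y)
      \<le> (\<Sum>x\<in>A. pmf q x * ln (pmf q x / pmf P x) * W x y)" for y
  proof -
    \<comment> \<open>The log-sum inequality letter by letter: ln u \<le> u - 1, where u is the
      ratio of the posterior probabilities of \<open>x\<close> given \<open>y\<close> under
      \<open>P\<close> and under \<open>q\<close>.\<close>
    have *: "pmf q x * W x y * (ln (?r y) - ln (?R y)) - pmf q x * ln (pmf q x / pmf P x) * W x y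
        \<le> ?r y * (pmf P x * W x y / ?R y) - pmf q x * W x y" if x: "x \<in> A" for x
    proof (cases "pmf q x = 0 \<or> W x y = 0")
      case True
      then show ?thesis using W[OF x] output_density_nonneg by auto
    next
      case False
      then have qx: "0 < pmf q x" and Px: "0 < pmf P x" and Wx: "0 < W x y"
        using q W[OF x, of y] by (auto simp: pmf_positive set_pmf_iff subset_iff less_le)
      have r: "0 < ?r y" "0 < ?R y"
        using output_density_ge[OF x, of q y] output_density_ge[OF x, of P y]
          mult_pos_pos[OF qx Wx] mult_pos_pos[OF Px Wx] by linarith+
      have "ln (?r y) - ln (?R y) - ln (pmf q x / pmf P x) = ln (pmf P x * ?r y / (pmf q x * ?R y))"
        using r qx Px by (simp add: ln_div ln_mult)
      also have "\<dots> \<le> pmf P x * ?r y / (pmf q x * ?R y) - 1"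
        using r qx Px by (intro ln_le_minus_one) auto
      finally have "pmf q x * W x y * (ln (?r y) - ln (?R y) - ln (pmf q x / pmf P x))
          \<le> pmf q x * W x y * (pmf P x * ?r y / (pmf q x * ?R y) - 1)"
        using qx Wx by (intro mult_left_mono) auto
      then show ?thesis using qx by (simp add: algebra_simps)
    qed
    have "(\<Sum>x\<in>A. pmf q x * W x y * (ln (?r y) - ln (?R y))
          - pmf q x * ln (pmf q x / pmf P x) * W x y)
        \<le> (\<Sum>x\<in>A. ?r y * (pmf P x * W x y / ?R y) - pmf q x * W x y)"
      by (intro sum_mono *)
    moreover have "(\<Sum>x\<in>A. ?r y * (pmf P x * W x y / ?R y) - pmf q x * W x y)
        = ?r y * (?R y / ?R y) - ?r y"
      unfolding sum_subtractf sum_distrib_left[symmetric] sum_divide_distrib[symmetric]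
      by (simp only: output_density_def)
    \<comment> \<open>The posterior weights under \<open>P\<close> sum to 1, or to 0 where
      \<open>?R y\<close> is 0, since division by zero gives 0.\<close>
    moreover have "?r y * (?R y / ?R y) - ?r y \<le> 0"
      using output_density_nonneg[of q y] by (cases "?R y = 0") auto
    moreover have "(\<Sum>x\<in>A. pmf q x * W x y * (ln (?r y) - ln (?R y))
          - pmf q x * ln (pmf q x / pmf P x) * W x y)
        = (?r y * ln (?r y) - ?r y * ln (?R y)) - (\<Sum>x\<in>A. pmf q x * ln (pmf q x / pmf P x) * W x y)"
      unfolding sum_subtractf sum_distrib_right[symmetric]
      by (simp only: output_density_def right_diff_distrib)
    ultimately show ?thesis by linarith
  qed
  have eq: "ln 2 * mutual_info M A W q = (\<Sum>x\<in>A. pmf q x * info_density M A W P x)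
      - (\<integral>y. ?r y * ln (?r y) - ?r y * ln (?R y) \<partial>M)"
    using int output_cross_entropy(2)[OF q]
    by (simp add: mutual_info_ln info_density_def right_diff_distrib sum_subtractf)
  have "(\<integral>y. ?r y - ?R y \<partial>M) \<le> (\<integral>y. ?r y * ln (?r y) - ?r y * ln (?R y) \<partial>M)"
    using int by (intro integral_mono lower Bochner_Integration.integrable_diff
        output_density_integrable)
  moreover have "(\<integral>y. ?r y - ?R y \<partial>M) = 0"
    using output_density_integral P q by (simp add: output_density_integrable)
  ultimately show "ln 2 * mutual_info M A W q \<le> (\<Sum>x\<in>A. pmf q x * info_density M A W P x)"
    using eq by linarith
  have iW: "integrable M (\<lambda>y. pmf q x * ln (pmf q x / pmf P x) * W x y)" if "x \<in> A" for x
    using channel that by (auto simp: channel_on_def)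
  have "(\<integral>y. ?r y * ln (?r y) - ?r y * ln (?R y) \<partial>M)
      \<le> (\<integral>y. (\<Sum>x\<in>A. pmf q x * ln (pmf q x / pmf P x) * W x y) \<partial>M)"
    using int by (intro integral_mono upper Bochner_Integration.integrable_diff
        Bochner_Integration.integrable_sum iW)
  also have "\<dots> = (\<Sum>x\<in>A. \<integral>y. pmf q x * ln (pmf q x / pmf P x) * W x y \<partial>M)"
    by (intro Bochner_Integration.integral_sum iW)
  also have "\<dots> = ?D"
    using channel by (intro sum.cong) (auto simp: channel_on_def)
  also have "?D = (\<Sum>x\<in>set_pmf q. pmf q x * ln (pmf q x / pmf P x))"
    using P q fin by (intro sum.mono_neutral_right) (auto simp: set_pmf_iff)
  finally show "(\<Sum>x\<in>A. pmf q x * info_density M A W P x)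
        - (\<Sum>x\<in>set_pmf q. pmf q x * ln (pmf q x / pmf P x)) \<le> ln 2 * mutual_info M A W q"
    using eq by linarith
qed

text \<open>With \<open>P\<close> as its own reference the divergence is 0 and the two bounds of the
  sandwich coincide.\<close>

lemma mutual_info_eq_info_density:
  assumes "set_pmf P \<subseteq> A"
  shows "ln 2 * mutual_info M A W P = (\<Sum>x\<in>A. pmf P x * info_density M A W P x)"
proof -
  have "(\<Sum>x\<in>set_pmf P. pmf P x * ln (pmf P x / pmf P x)) = 0"
    by (intro sum.neutral) (simp add: set_pmf_iff)
  then show ?thesis using mutual_info_sandwich[OF assms order_refl] by simp
qed

end

section \<open>Memoryless channels on blocks\<close>

text \<open>The logarithm of the product splits into a sum. In the \<open>i\<close>-th summand only
  factor \<open>i\<close> carries a logarithm, and by Fubini the other factors integrate to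
  1.\<close>

lemma product_cross_entropy:
  fixes f g :: "nat \<Rightarrow> 'b \<Rightarrow> real"
  assumes "sigma_finite_measure M"
    and f: "\<And>i. i < n \<Longrightarrow> integrable M (f i)" "\<And>i. i < n \<Longrightarrow> (\<integral>y. f i y \<partial>M) = 1"
    and fg: "\<And>i. i < n \<Longrightarrow> integrable M (\<lambda>y. f i y * ln (g i y))"
    and g: "\<And>i y. i < n \<Longrightarrow> f i y \<noteq> 0 \<Longrightarrow> 0 < g i y"
  shows "integrable (\<Pi>\<^sub>M i\<in>{..<n}. M) (\<lambda>y. (\<Prod>i<n. f i (y i)) * ln (\<Prod>i<n. g i (y i)))" (is ?I)
    and "(\<integral>y. (\<Prod>i<n. f i (y i)) * ln (\<Prod>i<n. g i (y i)) \<partial>(\<Pi>\<^sub>M i\<in>{..<n}. M))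
       = (\<Sum>i<n. \<integral>y. f i y * ln (g i y) \<partial>M)" (is ?E)
proof -
  interpret product_sigma_finite "\<lambda>_::nat. M"
    using assms(1) by (simp add: product_sigma_finite_def)
  define F where "F i j y = (if j = i then f j y * ln (g j y) else f j y)" for i j y
  have F: "(\<Prod>j<n. F i j (y j)) = (\<Prod>j<n. f j (y j)) * ln (g i (y i))" if "i < n" for i y
  proof -
    have "(\<Prod>j<n. F i j (y j)) = (\<Prod>j<n. f j (y j) * (if j = i then ln (g j (y j)) else 1))"
      by (intro prod.cong) (auto simp: F_def)
    then show ?thesis using that by (simp add: prod.distrib prod.delta)
  qed
  have eq: "(\<lambda>y. (\<Prod>i<n. f i (y i)) * ln (\<Prod>i<n. g i (y i))) = (\<lambda>y. \<Sum>i<n. \<Prod>j<n. F i j (y j))"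
  proof
    fix y
    have "(\<Prod>i<n. f i (y i)) * ln (\<Prod>i<n. g i (y i)) = (\<Prod>i<n. f i (y i)) * (\<Sum>i<n. ln (g i (y i)))"
    \<comment> \<open>The logarithm of the product splits only where all \<open>g i (y i)\<close>
      are nonzero. Elsewhere some \<open>f i (y i)\<close> is 0 and both sides vanish.\<close>
    proof (cases "(\<Prod>i<n. f i (y i)) = 0")
      case False
      then have "f i (y i) \<noteq> 0" if "i < n" for i using that by auto
      then have "g i (y i) \<noteq> 0" if "i < n" for i using g that less_irrefl by metis
      then have "ln (\<Prod>i<n. g i (y i)) = (\<Sum>i<n. ln (g i (y i)))"
        by (intro ln_prod) auto
      then show ?thesis by (simp only:)
    qed (simp only: mult_zero_left)
    also have "\<dots> = (\<Sum>i<n. \<Prod>j<n. F i j (y j))"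
      unfolding sum_distrib_left by (intro sum.cong refl F[symmetric]) simp
    finally show "(\<Prod>i<n. f i (y i)) * ln (\<Prod>i<n. g i (y i)) = (\<Sum>i<n. \<Prod>j<n. F i j (y j))" .
  qed
  have iF: "integrable M (F i j)" if "j < n" for i j
    using f fg that by (cases "j = i") (simp_all add: F_def[abs_def])
  have iP: "integrable (\<Pi>\<^sub>M i\<in>{..<n}. M) (\<lambda>y. \<Prod>j<n. F i j (y j))" for i
    using iF by (intro product_integrable_prod) auto
  show ?I unfolding eq by (intro Bochner_Integration.integrable_sum iP)
  have "(\<integral>y. (\<Prod>j<n. F i j (y j)) \<partial>(\<Pi>\<^sub>M i\<in>{..<n}. M)) = (\<integral>y. f i y * ln (g i y) \<partial>M)"
    if i: "i < n" for i
  proof -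
    have "(\<integral>y. (\<Prod>j<n. F i j (y j)) \<partial>(\<Pi>\<^sub>M i\<in>{..<n}. M)) = (\<Prod>j<n. \<integral>y. F i j y \<partial>M)"
      using iF by (intro product_integral_prod) auto
    also have "\<dots> = (\<Prod>j<n. if j = i then \<integral>y. f i y * ln (g i y) \<partial>M else 1)"
      using f(2) by (intro prod.cong) (auto simp: F_def)
    finally show ?thesis using i by simp
  qed
  then show ?E unfolding eq by (simp add: iP)
qed

lemma output_density_iid:
  assumes "finite X"
  shows "output_density (blocks n X) (\<lambda>x y. \<Prod>i<n. w (x i) (y i)) (iid_pmf n p) y
     = (\<Prod>i<n. output_density X w p (y i))"
proof -
  have "output_density (blocks n X) (\<lambda>x y. \<Prod>i<n. w (x i) (y i)) (iid_pmf n p) y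
     = (\<Sum>x\<in>blocks n X. \<Prod>i<n. pmf p (x i) * w (x i) (y i))"
    unfolding output_density_def by (intro sum.cong) (auto simp: pmf_iid prod.distrib)
  also have "\<dots> = (\<Prod>i<n. output_density X w p (y i))"
    unfolding output_density_def using assms by (rule sum_blocks_prod)
  finally show ?thesis .
qed

text \<open>Entropy and cross entropy of product densities are both additive: one is the product
  formula with \<open>w (x i)\<close> inside the logarithm, the other with the single-letter output
  density, as independent inputs give independent outputs.\<close>

lemma
  assumes sf: "sigma_finite_measure M" and ch: "channel_on M X w"
  shows channel_on_blocks:
      "channel_on (\<Pi>\<^sub>M i\<in>{..<n}. M) (blocks n X) (\<lambda>x y. \<Prod>i<n. w (x i) (y i))"
    and info_density_blocks: "x \<in> blocks n (set_pmf p) \<Longrightarrow> set_pmf p \<subseteq> X \<Longrightarrow>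
      info_density (\<Pi>\<^sub>M i\<in>{..<n}. M) (blocks n X) (\<lambda>x y. \<Prod>i<n. w (x i) (y i)) (iid_pmf n p) x
      = (\<Sum>i<n. info_density M X w p (x i))"
proof -
  interpret product_sigma_finite "\<lambda>_::nat. M"
    using sf by (simp add: product_sigma_finite_def)
  have w: "0 \<le> w a y" "integrable M (w a)" "(\<integral>y. w a y \<partial>M) = 1"
    "integrable M (\<lambda>y. w a y * ln (w a y))" if "a \<in> X" for a y
    using ch that by (auto simp: channel_on_def)
  have mem: "x i \<in> B" if "x \<in> blocks n B" "i < n" for x :: "nat \<Rightarrow> 'b" and i B
    using that by (auto simp: blocks_def)
  have pos: "0 < w a y" if "a \<in> X" "w a y \<noteq> 0" for a y
    using w(1)[OF that(1), of y] that(2) by simp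
  have ent: "integrable (\<Pi>\<^sub>M i\<in>{..<n}. M) (\<lambda>y. (\<Prod>i<n. w (x i) (y i)) * ln (\<Prod>i<n. w (x i) (y i)))"
    "(\<integral>y. (\<Prod>i<n. w (x i) (y i)) * ln (\<Prod>i<n. w (x i) (y i)) \<partial>(\<Pi>\<^sub>M i\<in>{..<n}. M))
      = (\<Sum>i<n. \<integral>y. w (x i) y * ln (w (x i) y) \<partial>M)"
    if "x \<in> blocks n X" for x
    using product_cross_entropy[OF sf, of n "\<lambda>i. w (x i)" "\<lambda>i. w (x i)"] w pos mem[OF that]
    by auto
  have "finite X" using ch by (simp add: channel_on_def)
  then show "channel_on (\<Pi>\<^sub>M i\<in>{..<n}. M) (blocks n X) (\<lambda>x y. \<Prod>i<n. w (x i) (y i))"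
    unfolding channel_on_def
  proof (intro conjI ballI allI)
    fix x assume x: "x \<in> blocks n X"
    show "0 \<le> (\<Prod>i<n. w (x i) (y i))" for y
      using w(1) mem[OF x] by (intro prod_nonneg) auto
    show "integrable (\<Pi>\<^sub>M i\<in>{..<n}. M) (\<lambda>y. \<Prod>i<n. w (x i) (y i))"
      using w(2) mem[OF x] by (intro product_integrable_prod) auto
    have "(\<integral>y. (\<Prod>i<n. w (x i) (y i)) \<partial>(\<Pi>\<^sub>M i\<in>{..<n}. M)) = (\<Prod>i<n. \<integral>y. w (x i) y \<partial>M)"
      using w(2) mem[OF x] by (intro product_integral_prod) auto
    then show "(\<integral>y. (\<Prod>i<n. w (x i) (y i)) \<partial>(\<Pi>\<^sub>M i\<in>{..<n}. M)) = 1"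
      using w(3) mem[OF x] by simp
  qed (auto simp: finite_blocks ent)
  assume x: "x \<in> blocks n (set_pmf p)" and p: "set_pmf p \<subseteq> X"
  have xX: "x \<in> blocks n X" using x p by (auto simp: blocks_def)
  have xi: "x i \<in> X" "x i \<in> set_pmf p" if "i < n" for i using mem x xX that by auto
  have gpos: "0 < output_density X w p y" if "i < n" "w (x i) y \<noteq> 0" for i y
  proof -
    have "0 < pmf p (x i) * w (x i) y"
      using pos xi that by (intro mult_pos_pos) (auto simp: pmf_positive)
    then show ?thesis using output_density_ge[OF ch xi(1)[OF that(1)], of p y] by linarith
  qed
  have "(\<integral>y. (\<Prod>i<n. w (x i) (y i)) * ln (\<Prod>i<n. output_density X w p (y i)) \<partial>(\<Pi>\<^sub>M i\<in>{..<n}. M))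
      = (\<Sum>i<n. \<integral>y. w (x i) y * ln (output_density X w p y) \<partial>M)"
    using w xi gpos integrable_ln_output_density[OF ch]
    by (intro product_cross_entropy(2)[OF sf]) auto
  then show "info_density (\<Pi>\<^sub>M i\<in>{..<n}. M) (blocks n X) (\<lambda>x y. \<Prod>i<n. w (x i) (y i)) (iid_pmf n p) x
      = (\<Sum>i<n. info_density M X w p (x i))"
    using \<open>finite X\<close>
    by (simp add: info_density_def output_density_iid ent(2)[OF xX] sum_subtractf)
qed

section \<open>Additive noise on the complex plane\<close>

lemma lborel_shift:
  fixes f :: "complex \<Rightarrow> real"
  assumes "integrable lborel f"
  shows "integrable lborel (\<lambda>y. f (y - a))" "(\<integral>y. f (y - a) \<partial>lborel) = (\<integral>y. f y \<partial>lborel)"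
proof -
  have d: "distr lborel borel (\<lambda>y. y - a) = (lborel :: complex measure)"
    using lborel_distr_plus[of "- a"] by (simp add: uminus_add_conv_diff cong: distr_cong)
  have [measurable]: "f \<in> borel_measurable borel" using assms by auto
  have "integrable (distr lborel borel (\<lambda>y. y - a)) f" using assms d by simp
  then show "integrable lborel (\<lambda>y. f (y - a))" by (subst (asm) integrable_distr_eq) auto
  have "(\<integral>y. f y \<partial>distr lborel borel (\<lambda>y. y - a)) = (\<integral>y. f (y - a) \<partial>lborel)"
    by (subst integral_distr) auto
  then show "(\<integral>y. f (y - a) \<partial>lborel) = (\<integral>y. f y \<partial>lborel)" using d by simp
qed

text \<open>All conditional densities are translates of the noise density, so translation invariance
  carries its total mass and finite entropy over to each of them.\<close>

lemma channel_on_additive_noise: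
  assumes "finite X" "prob_density h" "integrable lborel (\<lambda>z. h z * log 2 (h z))"
  shows "channel_on lborel X (\<lambda>x y. h (y - x))"
proof -
  have h: "h \<in> borel_measurable borel" "\<And>z. 0 \<le> h z" "(\<integral>\<^sup>+z. ennreal (h z) \<partial>lborel) = ennreal 1"
    using assms(2) by (auto simp: prob_density_def)
  have "integrable lborel h \<and> (\<integral>z. h z \<partial>lborel) = 1"
    using nn_integral_eq_integrable[of h lborel 1] h by simp
  then have hi: "integrable lborel h" "(\<integral>z. h z \<partial>lborel) = 1" by auto
  have "integrable lborel (\<lambda>z. ln 2 * (h z * log 2 (h z)))"
    using assms(3) by (intro integrable_mult_right) auto
  then have "integrable lborel (\<lambda>z. h z * ln (h z))" by (simp add: log_def)
  note hl = lborel_shift(1)[OF this]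
  show ?thesis
    unfolding channel_on_def using assms(1) h(2) hl lborel_shift[OF hi(1)] hi(2) by auto
qed

section \<open>Limits of information and energy per letter\<close>

text \<open>With the product PMF as reference, the block information in nats differs from the mean
  of an additive function by at most the divergence. Per letter that error vanishes and the mean
  converges.\<close>

lemma block_mutual_info_rate:
  assumes sf: "sigma_finite_measure M" and ch: "channel_on M X w" and p: "set_pmf p \<subseteq> X"
    and sub: "\<And>n. n \<ge> 1 \<Longrightarrow> set_pmf (q n) \<subseteq> blocks n (set_pmf p)"
    and lim: "(\<lambda>n. (\<Sum>x\<in>set_pmf (q n). pmf (q n) x * ln (pmf (q n) x / pmf (iid_pmf n p) x)) / n)
       \<longlonglongrightarrow> 0"
  shows "(\<lambda>n. mutual_info (\<Pi>\<^sub>M i\<in>{..<n}. M) (blocks n X) (\<lambda>x y. \<Prod>i<n. w (x i) (y i)) (q n) / n)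
     \<longlonglongrightarrow> mutual_info M X w p"
proof -
  let ?I = "\<lambda>n. mutual_info (\<Pi>\<^sub>M i\<in>{..<n}. M) (blocks n X) (\<lambda>x y. \<Prod>i<n. w (x i) (y i)) (q n)"
  let ?D = "\<lambda>n. \<Sum>x\<in>set_pmf (q n). pmf (q n) x * ln (pmf (q n) x / pmf (iid_pmf n p) x)"
  let ?d = "info_density M X w p"
  let ?S = "\<lambda>n. \<Sum>x\<in>blocks n (set_pmf p). pmf (q n) x * (\<Sum>i<n. ?d (x i))"
  have finX: "finite X" using ch by (simp add: channel_on_def)
  then have finp: "finite (set_pmf p)" using p finite_subset by blast
  have S: "(\<lambda>n. ?S n / n) \<longlonglongrightarrow> (\<Sum>a\<in>set_pmf p. pmf p a * ?d a)"
    using finp sub lim by (rule averages_tendsto)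
  have "ln 2 * mutual_info M X w p = (\<Sum>a\<in>X. pmf p a * ?d a)"
    using ch p by (rule mutual_info_eq_info_density)
  also have "\<dots> = (\<Sum>a\<in>set_pmf p. pmf p a * ?d a)"
    using finX p by (intro sum.mono_neutral_right) (auto simp: set_pmf_iff)
  finally have Ip: "ln 2 * mutual_info M X w p = (\<Sum>a\<in>set_pmf p. pmf p a * ?d a)" .
  have bounds: "ln 2 * ?I n \<le> ?S n \<and> ?S n - ?D n \<le> ln 2 * ?I n" if n: "n \<ge> 1" for n
  proof -
    let ?dn = "info_density (\<Pi>\<^sub>M i\<in>{..<n}. M) (blocks n X) (\<lambda>x y. \<Prod>i<n. w (x i) (y i)) (iid_pmf n p)"
    have sX: "set_pmf (iid_pmf n p) \<subseteq> blocks n X"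
      using p by (auto simp: set_iid_pmf blocks_def)
    have sq: "set_pmf (q n) \<subseteq> set_pmf (iid_pmf n p)" using sub[OF n] by (simp add: set_iid_pmf)
    have "(\<Sum>x\<in>blocks n X. pmf (q n) x * ?dn x) = (\<Sum>x\<in>blocks n (set_pmf p). pmf (q n) x * ?dn x)"
      using sX sub[OF n] finX
      by (intro sum.mono_neutral_right) (auto simp: set_iid_pmf finite_blocks set_pmf_iff)
    also have "\<dots> = ?S n"
      by (intro sum.cong refl arg_cong2[of _ _ _ _ "(*)"] info_density_blocks[OF sf ch _ p])
    finally show ?thesis
      using mutual_info_sandwich[OF channel_on_blocks[OF sf ch] sX sq] by simp
  qed
  have "(\<lambda>n. ln 2 * ?I n / n) \<longlonglongrightarrow> (\<Sum>a\<in>set_pmf p. pmf p a * ?d a)"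
  proof (rule tendsto_sandwich)
    show "eventually (\<lambda>n. ?S n / n - ?D n / n \<le> ln 2 * ?I n / n) sequentially"
      using eventually_ge_at_top[of 1]
      by eventually_elim (use bounds in \<open>simp add: divide_right_mono flip: diff_divide_distrib\<close>)
    show "eventually (\<lambda>n. ln 2 * ?I n / n \<le> ?S n / n) sequentially"
      using eventually_ge_at_top[of 1]
      by eventually_elim (use bounds in \<open>simp add: divide_right_mono\<close>)
    show "(\<lambda>n. ?S n / n - ?D n / n) \<longlonglongrightarrow> (\<Sum>a\<in>set_pmf p. pmf p a * ?d a)"
      using tendsto_diff[OF S lim] by simp
    show "(\<lambda>n. ?S n / n) \<longlonglongrightarrow> (\<Sum>a\<in>set_pmf p. pmf p a * ?d a)" by (rule S)
  qed
  then have "(\<lambda>n. (ln 2 * ?I n / n) / ln 2) \<longlonglongrightarrow> (ln 2 * mutual_info M X w p) / ln 2"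
    unfolding Ip by (intro tendsto_intros) auto
  then show ?thesis by simp
qed

theorem proposition3:
  fixes h :: "complex \<Rightarrow> real" and X :: "complex set"
    and p :: "complex pmf" and pt :: "nat \<Rightarrow> (nat \<Rightarrow> complex) pmf"
  assumes "finite X"
    and "prob_density h"
    and "integrable lborel (\<lambda>z. h z * log 2 (h z))"
    and "capacity_achieving h X p"
    and "strictly_concave_on (binding_budgets h X) (capacity h X)"
    and "(\<forall>n\<ge>1. is_ghc (dyadic_or_zero_on (blocks n X)) (iid_pmf n p) (pt n)) \<or>
         (\<forall>n\<ge>1. is_ghc (dyadic_on (blocks n (set_pmf p))) (iid_pmf n p) (pt n))"
  shows "(\<lambda>n. (block_energy X n (pt n) / real n, block_info h X n (pt n) / real n))
           \<longlonglongrightarrow> (energy X p, channel_info h X p)"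
proof (rule tendsto_Pair)
  have p: "set_pmf p \<subseteq> X" using assms(4) by (simp add: capacity_achieving_def is_arg_max_def)
  have fin: "finite (set_pmf p)" using p assms(1) finite_subset by blast
  let ?D = "\<lambda>n. \<Sum>x\<in>set_pmf (pt n). pmf (pt n) x * ln (pmf (pt n) x / pmf (iid_pmf n p) x)"
  obtain \<epsilon> where \<epsilon>: "\<epsilon> \<longlonglongrightarrow> (0::real)"
    and kl: "\<And>n. n \<ge> 1 \<Longrightarrow> kl_dist (pt n) (iid_pmf n p) \<le> ereal (real n * \<epsilon> n)"
    using ghc_divergence[OF fin p assms(6)] by blast
  \<comment> \<open>Finite divergence keeps the optimal PMF on blocks over the support of
    \<open>p\<close>, even when all blocks over \<open>X\<close> are admissible. The optimality
    assumption starts at n = 1, so the estimates do too.\<close>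
  have sub: "set_pmf (pt n) \<subseteq> blocks n (set_pmf p)" if "n \<ge> 1" for n
    using kl[OF that] by (simp add: kl_dist_le_ereal_iff set_iid_pmf)
  have D: "0 \<le> ?D n \<and> ?D n \<le> n * (ln 2 * \<epsilon> n)" if n: "n \<ge> 1" for n
  proof
    \<comment> \<open>Nonnegativity of the divergence is the variational inequality for the zero
      function, whose logarithmic term is ln 1.\<close>
    have "0 \<le> ?D n + ln (\<Sum>x\<in>set_pmf (iid_pmf n p). pmf (iid_pmf n p) x * exp 0)"
      using gibbs_variational[of "iid_pmf n p" "pt n" "\<lambda>_. 0"] sub[OF n] fin
      by (simp add: set_iid_pmf finite_blocks)
    then show "0 \<le> ?D n" using fin by (simp add: sum_pmf_eq_1 set_iid_pmf finite_blocks)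
    \<comment> \<open>The divergence bound is in bits, the averaging argument in nats; hence the
      factor ln 2.\<close>
    have "?D n / ln 2 \<le> n * \<epsilon> n"
      using kl[OF n] by (simp add: kl_dist_le_ereal_iff log_def sum_divide_distrib)
    then show "?D n \<le> n * (ln 2 * \<epsilon> n)" by (simp add: field_simps)
  qed
  have "(\<lambda>n. ln 2 * \<epsilon> n) \<longlonglongrightarrow> ln 2 * 0" by (intro tendsto_intros \<epsilon>)
  then have "(\<lambda>n. ln 2 * \<epsilon> n) \<longlonglongrightarrow> 0" by simp
  then have lim: "(\<lambda>n. ?D n / n) \<longlonglongrightarrow> 0"
  proof (rule tendsto_sandwich[OF _ _ tendsto_const, rotated 2])
    show "eventually (\<lambda>n. 0 \<le> ?D n / n) sequentially"
      using eventually_ge_at_top[of 1] by eventually_elim (use D in simp)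
    show "eventually (\<lambda>n. ?D n / n \<le> ln 2 * \<epsilon> n) sequentially"
      using eventually_ge_at_top[of 1] by eventually_elim (use D in \<open>simp add: field_simps\<close>)
  qed
  have "block_energy X n (pt n)
      = (\<Sum>x\<in>blocks n (set_pmf p). pmf (pt n) x * (\<Sum>i<n. (cmod (x i))\<^sup>2))" if n: "n \<ge> 1" for n
  proof -
    have "block_energy X n (pt n) = (\<Sum>x\<in>blocks n X. pmf (pt n) x * (\<Sum>i<n. (cmod (x i))\<^sup>2))"
      by (simp add: block_energy_def L2_set_def sum_nonneg)
    also have "\<dots> = (\<Sum>x\<in>blocks n (set_pmf p). pmf (pt n) x * (\<Sum>i<n. (cmod (x i))\<^sup>2))"
      using p sub[OF n] assms(1)
      by (intro sum.mono_neutral_right finite_blocks ballI) (auto simp: set_pmf_iff blocks_def)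
    finally show ?thesis .
  qed
  then have "eventually (\<lambda>n. (\<Sum>x\<in>blocks n (set_pmf p). pmf (pt n) x * (\<Sum>i<n. (cmod (x i))\<^sup>2)) / n
      = block_energy X n (pt n) / n) sequentially"
    by (intro eventually_mono[OF eventually_ge_at_top[of 1]]) simp
  moreover have "(\<lambda>n. (\<Sum>x\<in>blocks n (set_pmf p). pmf (pt n) x * (\<Sum>i<n. (cmod (x i))\<^sup>2)) / n)
      \<longlonglongrightarrow> (\<Sum>a\<in>set_pmf p. pmf p a * (cmod a)\<^sup>2)"
    using fin sub lim by (rule averages_tendsto)
  moreover have "(\<Sum>a\<in>set_pmf p. pmf p a * (cmod a)\<^sup>2) = energy X p"
    unfolding energy_def using assms(1) p
    by (intro sum.mono_neutral_left) (auto simp: set_pmf_iff)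
  ultimately show "(\<lambda>n. block_energy X n (pt n) / n) \<longlonglongrightarrow> energy X p"
    using Lim_transform_eventually by fastforce
  show "(\<lambda>n. block_info h X n (pt n) / n) \<longlonglongrightarrow> channel_info h X p"
    unfolding block_info_def channel_info_def
    using lborel.sigma_finite_measure_axioms channel_on_additive_noise[OF assms(1-3)] p sub lim
    by (rule block_mutual_info_rate)
qed

end
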